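(* Let $(X,d)$ be a metric space with a computable structure, let $T:X\to X$ be continuous, and let $f:\mathbf N\to\mathbf R$ be monotone with $f(n)\to\infty$. If $X$ is compact, then for every computable interpretation $I$ on $X$ and every $x\in X$ $$\mathcal K^{f,I}(x)=K^f(x).$$
   Context: **Strings and algorithmic information content.** $\Sigma=\{0,1\}^*$ is the set of finite (possibly empty) binary strings, $|s|$ is the length of $s$. Let $c:\Sigma\to\mathbf N$ be the bijection $\emptyset\mapsto0,\ 0\mapsto1,\ 1\mapsto2,\ 00\mapsto3,\ 01\mapsto4,\dots$ (length-lexicographic order). For $s=s_0\dots s_{n-1}$ put $\hat s=s_0s_0s_1s_1\dots s_{n-1}s_{n-1}01$. Let $A_1,A_2,\dots$ be a recursive enumeration of all Turing machines (partial recursive functions $\Sigma\to\Sigma$). A machine $\mathcal U$ is universal if $\mathcal U(\widehat{c^{-1}(m)}\,p)=A_m(p)$ for all $m,p$. A universal machine $\mathcal U$ is fixed once and for all, and $AIC(s)=\min\{|p|:\mathcal U(p)=s\}$. For words over a finite alphabet $\{0,\dots,N-1\}$, $AIC$ is defined in the same way through a fixed computable bijective encoding of such words as elements of $\Sigma$. **Computable structures.** A computable interpretation on a metric space $(X,d)$ is a map $I:\Sigma\to X$ with dense image for which there is a total recursive $D:\Sigma\times\Sigma\times\mathbf N\to\mathbf Q$ with $|d(I(s_1),I(s_2))-D(s_1,s_2,n)|\le2^{-n}$ for all $s_1,s_2,n$. Two computable interpretations $I_1,I_2$ are equivalent if there is a total recursive $D^*:\Sigma\times\Sigma\times\mathbf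 N\to\mathbf Q$ with $|d(I_1(s_1),I_2(s_2))-D^*(s_1,s_2,n)|\le2^{-n}$ for all $s_1,s_2,n$. A computable structure is an equivalence class of computable interpretations. **Orbit complexity via open covers.** For a finite open cover $\beta=\{B_0,\dots,B_{N-1}\}$ of $X$ let $\varphi_\beta(x)=\{\omega\in\{0,\dots,N-1\}^{\mathbf N}:T^n(x)\in B_{\omega(n)}\ \forall n\in\mathbf N\}$, and let $\omega^n$ be the word of the first $n$ digits of $\omega$. Put $$K^f(x,T,\beta)=\limsup_{n\to\infty}\ \min_{\omega\in\varphi_\beta(x)}\frac{AIC(\omega^n)}{f(n)},\qquad K^f(x)=K^f(x,T)=\sup_\beta K^f(x,T,\beta)\in[0,+\infty],$$ the supremum being over all finite open covers $\beta$ of $X$. **Orbit complexity via interpretations.** Let $\Sigma^*$ here denote the set of finite sequences of elements of $\Sigma$, and fix a total recursive surjective function $\mathcal Q:\Sigma\to\Sigma^*$. For a program $p$ let $U(p)=I(\mathcal Q(\mathcal U(p)))$, where $I$ is applied termwise, so that $U(p)$ is a finite sequence of points of $X$; its terms are denoted $U_i(p)$, indexed from $i=0$. Define $$\mathcal K^I(x,n,\epsilon)=\min\{|p|:\ U(p)\in X^{n+1},\ \max_{0\le i\le n}d(U_i(p),T^i(x))<\epsilon\},$$ $$\mathcal K^{f,I}(x,\epsilon)=\limsup_{n\to\infty}\frac{\mathcal K^I(x,n,\epsilon)}{f(n)},\qquad \mathcal K^{f,I}(x)=\sup_{\epsilon>0}\mathcal K^{f,I}(x,\epsilon)\in[0,+\infty].$$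 *)

theory Defs
  imports "HOL-Analysis.Analysis" "HOL-Library.Nat_Bijection"
begin

section \<open>Partial recursive functions on the natural numbers\<close>

text \<open>
  Terms carry no arities. A term applied to an argument list of unsuitable length is undefined,
  so on the lists of each fixed length \<open>k\<close> every term computes a partial recursive function of
  \<open>k\<close> arguments, and every such function is computed by some term.
\<close>

datatype recf = Zero | Succ | Proj nat | Comp recf "recf list" | PrimRec recf recf | Mu recf

fun pr_eval :: "recf \<Rightarrow> nat list \<Rightarrow> nat option" where
  "pr_eval Zero xs = Some 0"
| "pr_eval Succ xs = (case xs of [x] \<Rightarrow> Some (Suc x) | _ \<Rightarrow> None)"
| "pr_eval (Proj i) xs = (if i < length xs then Some (xs ! i) else None)"
| "pr_eval (Comp f gs) xs =
     (if \<exists>g\<in>set gs. pr_eval g xs = None then None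
      else pr_eval f (map (\<lambda>g. the (pr_eval g xs)) gs))"
| "pr_eval (PrimRec f g) xs =
     (case xs of
        [] \<Rightarrow> None
      | x # ys \<Rightarrow>
          rec_nat (pr_eval f ys) (\<lambda>k r. Option.bind r (\<lambda>v. pr_eval g (k # v # ys))) x)"
| "pr_eval (Mu f) xs =
     (let P = (\<lambda>z. pr_eval f (z # xs) = Some 0 \<and> (\<forall>y<z. pr_eval f (y # xs) \<noteq> None))
      in if Ex P then Some (Least P) else None)"


section \<open>Strings, machines and algorithmic information content\<close>

text \<open>\<open>False\<close> and \<open>True\<close> stand for the digits 0 and 1.\<close>

type_synonym str = "bool list"
type_synonym machine = "str \<Rightarrow> str option"

text \<open>
  Bijective base-2 numeration: this is the position of a string in the length-lexicographic
  order, starting from 0.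
\<close>

definition str_code :: "str \<Rightarrow> nat" where
  "str_code s = foldl (\<lambda>k b. 2 * k + (if b then 2 else 1)) 0 s"

lemma str_code_Nil [simp]: "str_code [] = 0"
  by (simp add: str_code_def)

lemma str_code_snoc [simp]: "str_code (s @ [b]) = 2 * str_code s + (if b then 2 else 1)"
  by (simp add: str_code_def)

lemma bij_str_code: "bij str_code"
proof (rule bijI)
  have "str_code s = str_code t \<Longrightarrow> s = t" for s t
  proof (induction s arbitrary: t rule: rev_induct)
    case Nil
    then show ?case by (cases t rule: rev_cases) (auto split: if_splits)
  next
    case (snoc b s)
    show ?case
    proof (cases t rule: rev_cases)
      case Nil
      with snoc.prems show ?thesis by (simp split: if_splits)
    next
      case (snoc t' b')
      with snoc.prems have eq: "2 * str_code s + (if b then 2 else 1)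
          = 2 * str_code t' + (if b' then 2 else (1::nat))" by simp
      have "b = b'" by (rule ccontr) (use eq in \<open>cases b; cases b'; simp; presburger\<close>)
      with eq snoc snoc.IH show ?thesis by simp
    qed
  qed
  then show "inj str_code" by (auto intro: injI)
  have "\<exists>s. n = str_code s" for n
  proof (induction n rule: less_induct)
    case (less n)
    show ?case
    proof (cases "n = 0")
      case True
      then show ?thesis by (auto intro: exI [of _ "[]"])
    next
      case False
      then have "(n - 1) div 2 < n" by presburger
      from less [OF this] obtain s where s: "(n - 1) div 2 = str_code s" by blast
      have "n = str_code (s @ [even n])"
        unfolding str_code_snoc s [symmetric] using False by (cases "even n"; simp; presburger)
      then show ?thesis by blast
    qed
  qed
  then show "surj str_code" by (auto simp: surj_def)
qed

definition hat :: "str \<Rightarrow> str" where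
  "hat s = concat (map (\<lambda>b. [b, b]) s) @ [False, True]"

definition partial_recursive :: "machine \<Rightarrow> bool" where
  "partial_recursive M \<longleftrightarrow>
     (\<exists>r. \<forall>p. pr_eval r [str_code p] = map_option str_code (M p))"

text \<open>The machines are \<open>A 1, A 2, \<dots>\<close>; the value \<open>A 0\<close> plays no role.\<close>

definition recursive_enumeration :: "(nat \<Rightarrow> machine) \<Rightarrow> bool" where
  "recursive_enumeration A \<longleftrightarrow>
     A ` {1..} = {M. partial_recursive M} \<and>
     (\<exists>r. \<forall>m\<ge>1. \<forall>p. pr_eval r [m, str_code p] = map_option str_code (A m p))"

definition universal :: "(nat \<Rightarrow> machine) \<Rightarrow> machine \<Rightarrow> bool" where
  "universal A U \<longleftrightarrow>
     partial_recursive U \<and> (\<forall>m\<ge>1. \<forall>p. U (hat (inv str_code m) @ p) = A m p)"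

text \<open>For universal \<open>U\<close> every string has a program, so the minimum exists.\<close>

definition AIC :: "machine \<Rightarrow> str \<Rightarrow> nat" where
  "AIC U s = (LEAST k. \<exists>p. U p = Some s \<and> k = length p)"

definition words :: "nat \<Rightarrow> nat list set" where
  "words N = {w. set w \<subseteq> {..<N}}"

text \<open>
  \<open>enc N\<close> encodes the words over \<open>{0, \<dots>, N - 1}\<close>. Only nonempty alphabets are considered, since
  over the empty one there is just one word.
\<close>

definition word_encoding :: "(nat \<Rightarrow> nat list \<Rightarrow> str) \<Rightarrow> bool" where
  "word_encoding enc \<longleftrightarrow>
     (\<forall>N\<ge>1. bij_betw (enc N) (words N) UNIV \<and>
        (\<exists>r. \<forall>w\<in>words N. pr_eval r [list_encode w] = Some (str_code (enc N w))))"

definition AIC_word :: "machine \<Rightarrow> (nat \<Rightarrow> nat list \<Rightarrow> str) \<Rightarrow> nat \<Rightarrow> nat list \<Rightarrow> nat" where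
  "AIC_word U enc N w = AIC U (enc N w)"


section \<open>Computable structures\<close>

text \<open>A rational is coded through its reduced fraction with positive denominator.\<close>

definition rat_code :: "rat \<Rightarrow> nat" where
  "rat_code q = (case quotient_of q of (a, b) \<Rightarrow> prod_encode (int_encode a, nat b))"

definition recursive_approx :: "(str \<Rightarrow> str \<Rightarrow> nat \<Rightarrow> rat) \<Rightarrow> bool" where
  "recursive_approx D \<longleftrightarrow>
     (\<exists>r. \<forall>s t n. pr_eval r [str_code s, str_code t, n] = Some (rat_code (D s t n)))"

text \<open>For \<open>I = J\<close> this is the computability condition on a single interpretation.\<close>

definition mutually_computable :: "(str \<Rightarrow> 'a::metric_space) \<Rightarrow> (str \<Rightarrow> 'a) \<Rightarrow> bool" where
  "mutually_computable I J \<longleftrightarrow>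
     (\<exists>D. recursive_approx D \<and>
        (\<forall>s t n. \<bar>dist (I s) (J t) - of_rat (D s t n)\<bar> \<le> 1 / 2 ^ n))"

definition computable_interpretation :: "(str \<Rightarrow> 'a::metric_space) \<Rightarrow> bool" where
  "computable_interpretation I \<longleftrightarrow> closure (range I) = UNIV \<and> mutually_computable I I"

definition interpretation_equiv :: "((str \<Rightarrow> 'a::metric_space) \<times> (str \<Rightarrow> 'a)) set" where
  "interpretation_equiv =
     {(I, J). computable_interpretation I \<and> computable_interpretation J \<and> mutually_computable I J}"

definition computable_structure :: "(str \<Rightarrow> 'a::metric_space) set \<Rightarrow> bool" where
  "computable_structure S \<longleftrightarrow> S \<in> {I. computable_interpretation I} // interpretation_equiv"


section \<open>Orbit complexity via open covers\<close>

text \<open>A finite open cover is given as the list of its members \<open>B\<^sub>0, \<dots>, B\<^sub>N\<^sub>-\<^sub>1\<close>.\<close>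

definition open_cover :: "'a::topological_space set list \<Rightarrow> bool" where
  "open_cover B \<longleftrightarrow> (\<forall>V\<in>set B. open V) \<and> \<Union> (set B) = UNIV"

definition itineraries :: "('a \<Rightarrow> 'a) \<Rightarrow> 'a set list \<Rightarrow> 'a \<Rightarrow> (nat \<Rightarrow> nat) set" where
  "itineraries T B x = {\<omega>. \<forall>n. \<omega> n < length B \<and> (T ^^ n) x \<in> B ! \<omega> n}"

text \<open>
  For each \<open>n\<close> only finitely many words of length \<open>n\<close> occur, so the infimum over the
  itineraries is attained.
\<close>

definition cover_complexity ::
  "machine \<Rightarrow> (nat \<Rightarrow> nat list \<Rightarrow> str) \<Rightarrow> (nat \<Rightarrow> real) \<Rightarrow> ('a \<Rightarrow> 'a) \<Rightarrow> 'a set list \<Rightarrow> 'a \<Rightarrow> ereal" where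
  "cover_complexity U enc f T B x =
     limsup (\<lambda>n. INF \<omega>\<in>itineraries T B x.
       ereal (real (AIC_word U enc (length B) (map \<omega> [0..<n])) / f n))"

definition orbit_complexity ::
  "machine \<Rightarrow> (nat \<Rightarrow> nat list \<Rightarrow> str) \<Rightarrow> (nat \<Rightarrow> real) \<Rightarrow> ('a::topological_space \<Rightarrow> 'a) \<Rightarrow> 'a \<Rightarrow> ereal" where
  "orbit_complexity U enc f T x =
     (SUP B\<in>{B. open_cover B}. cover_complexity U enc f T B x)"


section \<open>Orbit complexity via interpretations\<close>

definition recursive_listing :: "(str \<Rightarrow> str list) \<Rightarrow> bool" where
  "recursive_listing Q \<longleftrightarrow>
     (\<exists>r. \<forall>s. pr_eval r [str_code s] = Some (list_encode (map str_code (Q s))))"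

definition point_output :: "machine \<Rightarrow> (str \<Rightarrow> str list) \<Rightarrow> (str \<Rightarrow> 'a) \<Rightarrow> str \<Rightarrow> 'a list option" where
  "point_output U Q I p = map_option (\<lambda>s. map I (Q s)) (U p)"

text \<open>
  For universal \<open>U\<close>, surjective \<open>Q\<close>, dense \<open>range I\<close> and \<open>\<epsilon> > 0\<close> a suitable program exists, so
  the minimum exists.
\<close>

definition shadow_length ::
  "machine \<Rightarrow> (str \<Rightarrow> str list) \<Rightarrow> (str \<Rightarrow> 'a::metric_space) \<Rightarrow> ('a \<Rightarrow> 'a) \<Rightarrow> 'a \<Rightarrow> nat \<Rightarrow> real \<Rightarrow> nat" where
  "shadow_length U Q I T x n \<epsilon> =
     (LEAST k. \<exists>p ys. point_output U Q I p = Some ys \<and> length ys = n + 1 \<and>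
        (MAX i\<in>{0..n}. dist (ys ! i) ((T ^^ i) x)) < \<epsilon> \<and> k = length p)"

definition shadow_complexity_at ::
  "machine \<Rightarrow> (str \<Rightarrow> str list) \<Rightarrow> (str \<Rightarrow> 'a::metric_space) \<Rightarrow> (nat \<Rightarrow> real) \<Rightarrow> ('a \<Rightarrow> 'a) \<Rightarrow> 'a \<Rightarrow> real \<Rightarrow> ereal" where
  "shadow_complexity_at U Q I f T x \<epsilon> =
     limsup (\<lambda>n. ereal (real (shadow_length U Q I T x n \<epsilon>) / f n))"

definition shadow_complexity ::
  "machine \<Rightarrow> (str \<Rightarrow> str list) \<Rightarrow> (str \<Rightarrow> 'a::metric_space) \<Rightarrow> (nat \<Rightarrow> real) \<Rightarrow> ('a \<Rightarrow> 'a) \<Rightarrow> 'a \<Rightarrow> ereal" where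
  "shadow_complexity U Q I f T x = (SUP \<epsilon>\<in>{0<..}. shadow_complexity_at U Q I f T x \<epsilon>)"

end

theory Submission imports Defs begin

text \<open>
  Both complexities are limits superior of program lengths divided by \<open>f n\<close>, and \<open>f n\<close> tends to
  infinity. So program lengths matter only up to an additive constant, and a universal machine pays
  just a constant for applying a fixed recursive function to the output of a program
  (\<open>universal_postprocess\<close>). It is therefore enough to translate, by recursive functions, shadowing
  point lists into itineraries and conversely.

  From itineraries to shadowing lists (\<open>shadow_length_le_itinerary\<close>): given \<open>\<epsilon>\<close>, compactness
  provides finitely many strings \<open>t\<close> whose balls of radius \<open>\<epsilon>\<close> around \<open>I t\<close> cover the space. For
  this cover, replacing each symbol of an itinerary by the string of its centre gives a shadowing
  list. The map from symbols to centres is a finite table, hence recursive.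

  From shadowing lists to itineraries (\<open>itinerary_le_shadow_length\<close>): a cover has a Lebesgue number
  \<open>e\<close>. Fix a sufficiently fine finite net of points \<open>I t\<close> and assign to each of them a member of
  the cover that contains its ball of radius \<open>e\<close>. For a string \<open>s\<close>, the approximation to the metric
  finds a net point near \<open>I s\<close>; every point of the space that is close enough to \<open>I s\<close> then lies in
  the member assigned to the net point. Applied to the strings of a shadowing list, this computes
  an itinerary.

  A shadowing list for \<open>n\<close> has \<open>n + 1\<close> points and the word compared with it has \<open>n\<close> symbols. Since
  \<open>f (n + 1)\<close> may be much larger than \<open>f n\<close>, an index shift would not do; the last point is dropped
  in one direction, and in the other it is supplied by one of finitely many recursive functions, one
  for each possible last symbol.

  The translations are total recursive functions, so most of the effort goes into closure
  properties of the latter, in particular for lists of numbers.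
\<close>

section \<open>Total recursive functions\<close>

text \<open>
  In \<open>recursive k g\<close> the arguments form a list, so that the closure rules below apply
  uniformly in the arity; the curried variants are the form in which recursive functions are used.
\<close>

definition recursive :: "nat \<Rightarrow> (nat list \<Rightarrow> nat) \<Rightarrow> bool" where
  "recursive k g \<longleftrightarrow> (\<exists>r. \<forall>xs. length xs = k \<longrightarrow> pr_eval r xs = Some (g xs))"

definition recursive1 :: "(nat \<Rightarrow> nat) \<Rightarrow> bool" where
  "recursive1 f \<longleftrightarrow> (\<exists>r. \<forall>x. pr_eval r [x] = Some (f x))"

definition recursive2 :: "(nat \<Rightarrow> nat \<Rightarrow> nat) \<Rightarrow> bool" where
  "recursive2 f \<longleftrightarrow> (\<exists>r. \<forall>x y. pr_eval r [x, y] = Some (f x y))"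

definition recursive3 :: "(nat \<Rightarrow> nat \<Rightarrow> nat \<Rightarrow> nat) \<Rightarrow> bool" where
  "recursive3 f \<longleftrightarrow> (\<exists>r. \<forall>x y z. pr_eval r [x, y, z] = Some (f x y z))"

lemma recursive1I: "recursive1 f" if "recursive 1 (\<lambda>xs. f (xs ! 0))"
proof -
  obtain r where "\<forall>xs. length xs = 1 \<longrightarrow> pr_eval r xs = Some (f (xs ! 0))"
    using \<open>recursive 1 _\<close> recursive_def by auto
  then show ?thesis unfolding recursive1_def by (intro exI [of _ r]) simp
qed

lemma recursive2I: "recursive2 f" if "recursive 2 (\<lambda>xs. f (xs ! 0) (xs ! 1))"
proof -
  obtain r where "\<forall>xs. length xs = 2 \<longrightarrow> pr_eval r xs = Some (f (xs ! 0) (xs ! 1))"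
    using \<open>recursive 2 _\<close> recursive_def by auto
  then show ?thesis unfolding recursive2_def by (intro exI [of _ r]) simp
qed

lemma recursive3I: "recursive3 f" if "recursive 3 (\<lambda>xs. f (xs ! 0) (xs ! 1) (xs ! 2))"
proof -
  obtain r where "\<forall>xs. length xs = 3 \<longrightarrow> pr_eval r xs = Some (f (xs ! 0) (xs ! 1) (xs ! 2))"
    using \<open>recursive 3 _\<close> recursive_def by auto
  then show ?thesis unfolding recursive3_def by (intro exI [of _ r]) simp
qed

lemma recursive_arg: "i < k \<Longrightarrow> recursive k (\<lambda>xs. xs ! i)"
  unfolding recursive_def by (rule exI [of _ "Proj i"]) simp

lemma recursive_comp1:
  assumes "recursive1 f" and "recursive k g"
  shows "recursive k (\<lambda>xs. f (g xs))"
proof -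
  obtain r where r: "\<forall>x. pr_eval r [x] = Some (f x)"
    using assms(1) recursive1_def by auto
  obtain s where s: "\<forall>xs. length xs = k \<longrightarrow> pr_eval s xs = Some (g xs)"
    using assms(2) by (auto simp: recursive_def)
  show ?thesis unfolding recursive_def
    by (rule exI [of _ "Comp r [s]"]) (simp add: r s)
qed

lemma recursive_comp2:
  assumes "recursive2 f" and "recursive k g" and "recursive k h"
  shows "recursive k (\<lambda>xs. f (g xs) (h xs))"
proof -
  obtain r where r: "\<forall>x y. pr_eval r [x, y] = Some (f x y)"
    using assms(1) recursive2_def by auto
  obtain s where s: "\<forall>xs. length xs = k \<longrightarrow> pr_eval s xs = Some (g xs)"
    using assms(2) by (auto simp: recursive_def)
  obtain t where t: "\<forall>xs. length xs = k \<longrightarrow> pr_eval t xs = Some (h xs)"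
    using assms(3) by (auto simp: recursive_def)
  show ?thesis unfolding recursive_def
    by (rule exI [of _ "Comp r [s, t]"]) (simp add: r s t)
qed

lemma recursive_comp3:
  assumes "recursive3 f" and "recursive k g" and "recursive k h" and "recursive k l"
  shows "recursive k (\<lambda>xs. f (g xs) (h xs) (l xs))"
proof -
  obtain r where r: "\<forall>x y z. pr_eval r [x, y, z] = Some (f x y z)"
    using assms(1) recursive3_def by auto
  obtain s where s: "\<forall>xs. length xs = k \<longrightarrow> pr_eval s xs = Some (g xs)"
    using assms(2) by (auto simp: recursive_def)
  obtain t where t: "\<forall>xs. length xs = k \<longrightarrow> pr_eval t xs = Some (h xs)"
    using assms(3) by (auto simp: recursive_def)
  obtain u where u: "\<forall>xs. length xs = k \<longrightarrow> pr_eval u xs = Some (l xs)"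
    using assms(4) by (auto simp: recursive_def)
  show ?thesis unfolding recursive_def
    by (rule exI [of _ "Comp r [s, t, u]"]) (simp add: r s t u)
qed

lemma recursive_Suc: "recursive k g \<Longrightarrow> recursive k (\<lambda>xs. Suc (g xs))"
proof (erule recursive_comp1 [rotated])
  show "recursive1 Suc" unfolding recursive1_def by (rule exI [of _ Succ]) simp
qed

lemma recursive_const: "recursive k (\<lambda>_. c)"
proof (induction c)
  case 0
  show ?case unfolding recursive_def by (rule exI [of _ Zero]) simp
next
  case (Suc c)
  then show ?case by (rule recursive_Suc)
qed

text \<open>Primitive recursion with a single parameter suffices, since parameters can be paired.\<close>

lemma recursive2_rec_nat:
  assumes "recursive1 b" and "recursive3 s"
  shows "recursive2 (\<lambda>n y. rec_nat (b y) (\<lambda>i v. s i v y) n)"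
proof -
  obtain r where r: "\<forall>x. pr_eval r [x] = Some (b x)"
    using assms(1) recursive1_def by auto
  obtain t where t: "\<forall>x y z. pr_eval t [x, y, z] = Some (s x y z)"
    using assms(2) recursive3_def by auto
  have "rec_nat (Some (b y)) (\<lambda>i w. Option.bind w (\<lambda>v. pr_eval t [i, v, y])) n
      = Some (rec_nat (b y) (\<lambda>i v. s i v y) n)" for n y
    by (induction n) (simp_all add: t)
  then show ?thesis unfolding recursive2_def
    by (intro exI [of _ "PrimRec r t"]) (simp add: r)
qed

text \<open>
  A search that always succeeds stays within the total functions. This is the only use of
  unbounded minimization.
\<close>

lemma recursive1_search:
  assumes "recursive2 g" and ex: "\<And>y. \<exists>z. g z y = 0"
  shows "recursive1 (\<lambda>y. LEAST z. g z y = 0)"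
proof -
  obtain r where r: "\<forall>x y. pr_eval r [x, y] = Some (g x y)"
    using assms(1) recursive2_def by auto
  show ?thesis unfolding recursive1_def
    by (intro exI [of _ "Mu r"]) (simp add: r ex)
qed

lemma recursive1_rec_nat:
  assumes "recursive2 s"
  shows "recursive1 (rec_nat b s)"
proof -
  have "recursive2 (\<lambda>n y. rec_nat b (\<lambda>i v. s i v) n)"
    by (rule recursive2_rec_nat [of "\<lambda>_. b" "\<lambda>i v y. s i v"])
      (rule recursive1I recursive3I, intro recursive_const recursive_comp2 [OF assms] recursive_arg; simp)+
  from recursive_comp2 [OF this, of 1 "\<lambda>xs. xs ! 0" "\<lambda>_. 0"]
  show ?thesis by (intro recursive1I) (simp add: recursive_arg recursive_const)
qed

lemma recursive2_add: "recursive2 (+)"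
proof -
  have "rec_nat y (\<lambda>i v. Suc v) n = n + y" for n y :: nat by (induction n) auto
  then have eq: "(+) = (\<lambda>n y. rec_nat y (\<lambda>i v. Suc v) n)" by (intro ext) simp
  show ?thesis unfolding eq
    by (rule recursive2_rec_nat)
      (rule recursive1I recursive3I, intro recursive_Suc recursive_arg; simp)+
qed

lemmas recursive_add = recursive_comp2 [OF recursive2_add]

lemma recursive2_mult: "recursive2 (*)"
proof -
  have "rec_nat 0 (\<lambda>i v. v + y) n = n * y" for n y :: nat by (induction n) auto
  then have eq: "(*) = (\<lambda>n y::nat. rec_nat 0 (\<lambda>i v. v + y) n)" by (intro ext) simp
  show ?thesis unfolding eq
    by (rule recursive2_rec_nat [of "\<lambda>_. 0"])
      (rule recursive1I recursive3I, intro recursive_const recursive_add recursive_arg; simp)+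
qed

lemmas recursive_mult = recursive_comp2 [OF recursive2_mult]

lemma recursive2_diff: "recursive2 (-)"
proof -
  have "rec_nat 0 (\<lambda>i v. i) n = n - 1" for n :: nat by (cases n) auto
  then have eq: "(\<lambda>n. n - 1) = rec_nat 0 (\<lambda>i v. i)" by (intro ext) simp
  have pred: "recursive1 (\<lambda>n. n - 1)" unfolding eq
    by (intro recursive1_rec_nat recursive2I recursive_arg) simp
  have "rec_nat y (\<lambda>i v. v - 1) n = y - n" for n y :: nat by (induction n) auto
  then have eq: "(\<lambda>n y. y - n) = (\<lambda>n y::nat. rec_nat y (\<lambda>i v. v - 1) n)" by (intro ext) simp
  have "recursive2 (\<lambda>n y. y - n)" unfolding eq
    by (rule recursive2_rec_nat)
      (rule recursive1I recursive3I, intro recursive_comp1 [OF pred] recursive_arg; simp)+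
  from recursive_comp2 [OF this, of 2 "\<lambda>xs. xs ! 1" "\<lambda>xs. xs ! 0"]
  show ?thesis by (intro recursive2I) (simp add: recursive_arg)
qed

lemmas recursive_diff = recursive_comp2 [OF recursive2_diff]

lemmas recursive_arith =
  recursive_arg recursive_const recursive_Suc recursive_add recursive_mult recursive_diff

lemma recursive_if_zero:
  assumes "recursive k c" and "recursive k g" and "recursive k h"
  shows "recursive k (\<lambda>xs. if c xs = 0 then g xs else h xs)"
proof -
  have eq: "(\<lambda>xs. if c xs = 0 then g xs else h xs)
      = (\<lambda>xs. (1 - c xs) * g xs + (1 - (1 - c xs)) * h xs)" by auto
  show ?thesis unfolding eq by (intro recursive_arith assms)
qed

text \<open>
  This turns decoding problems into encoding problems: an encoding that is onto need only be
  searched for a preimage.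
\<close>

lemma recursive1_inverse:
  assumes "recursive1 g" and "surj g"
  obtains h where "recursive1 h" and "\<And>z. g (h z) = z"
proof
  have ex: "\<exists>c. (g c - z) + (z - g c) = 0" for z
    using assms(2) by (metis add_0 diff_self_eq_0 surj_def)
  show "recursive1 (\<lambda>z. LEAST c. (g c - z) + (z - g c) = 0)"
    by (rule recursive1_search [OF recursive2I ex])
      (intro recursive_arith recursive_comp1 [OF assms(1)]; simp)
  show "g (LEAST c. (g c - z) + (z - g c) = 0) = z" for z
    using LeastI_ex [OF ex [of z]] by linarith
qed

text \<open>
  Testing finitely many candidates one after the other yields the label of the first success. With
  equality tests this is lookup in a finite table, with distance tests it selects a nearby net point.
\<close>

lemma recursive1_finite_choice:
  assumes "\<And>t. t \<in> set ts \<Longrightarrow> recursive1 (P t)"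
  obtains h where "recursive1 h"
    and "\<And>x. \<exists>t\<in>set ts. P t x = 0 \<Longrightarrow> \<exists>t\<in>set ts. P t x = 0 \<and> h x = lab t"
proof -
  have "\<exists>h. recursive1 h \<and> (\<forall>x. (\<exists>t\<in>set ts. P t x = 0) \<longrightarrow> (\<exists>t\<in>set ts. P t x = 0 \<and> h x = lab t))"
    using assms
  proof (induction ts)
    case Nil
    show ?case by (intro exI [of _ "\<lambda>_. 0"] conjI recursive1I recursive_const) simp
  next
    case (Cons t ts)
    then obtain h where h: "recursive1 h"
      "\<forall>x. (\<exists>t\<in>set ts. P t x = 0) \<longrightarrow> (\<exists>t\<in>set ts. P t x = 0 \<and> h x = lab t)" by auto
    have P: "recursive1 (P t)" using Cons.prems by simp
    have "recursive1 (\<lambda>x. if P t x = 0 then lab t else h x)"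
      by (intro recursive1I recursive_if_zero recursive_comp1 [OF P] recursive_comp1 [OF h(1)]
          recursive_const recursive_arg zero_less_one)
    moreover have "\<exists>s\<in>set (t # ts). P s x = 0 \<and> (if P t x = 0 then lab t else h x) = lab s"
      if "\<exists>s\<in>set (t # ts). P s x = 0" for x
      using that h(2) by (cases "P t x = 0") auto
    ultimately show ?case
      by (intro exI [of _ "\<lambda>x. if P t x = 0 then lab t else h x"]) blast
  qed
  with that show ?thesis by blast
qed

section \<open>Coded pairs and lists\<close>

lemma recursive1_triangle: "recursive1 triangle"
proof -
  have "rec_nat 0 (\<lambda>i v. v + Suc i) n = triangle n" for n by (induction n) auto
  then have eq: "triangle = rec_nat 0 (\<lambda>i v. v + Suc i)" by (intro ext) simp
  show ?thesis unfolding eq by (intro recursive1_rec_nat recursive2I recursive_arith) auto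
qed

lemmas recursive_triangle = recursive_comp1 [OF recursive1_triangle]

lemma recursive_prod_encode:
  assumes "recursive k g" and "recursive k h"
  shows "recursive k (\<lambda>xs. prod_encode (g xs, h xs))"
  unfolding prod_encode_def prod.case by (intro recursive_add recursive_triangle assms)

lemma triangle_mono: "m \<le> n \<Longrightarrow> triangle m \<le> triangle n"
  unfolding triangle_def by (intro div_le_mono mult_le_mono) auto

text \<open>
  Pairs are numbered diagonal by diagonal, and the diagonal with sum \<open>s\<close> starts at
  \<open>triangle s\<close>. The sum of the components is thus found by searching for the first diagonal that
  starts beyond \<open>z\<close>; both components follow from it by subtraction.
\<close>

lemma recursive1_diagonal:
  "recursive1 (\<lambda>z. fst (prod_decode z) + snd (prod_decode z))"
proof -
  have ex: "\<exists>s. Suc z - triangle (Suc s) = 0" for z by (rule exI [of _ z]) simp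
  have rec: "recursive1 (\<lambda>z. LEAST s. Suc z - triangle (Suc s) = 0)"
    by (rule recursive1_search [OF recursive2I ex])
      (intro recursive_arith recursive_triangle; simp)
  have "(LEAST s. Suc z - triangle (Suc s) = 0) = fst (prod_decode z) + snd (prod_decode z)" for z
  proof -
    obtain a b where ab: "prod_decode z = (a, b)" by fastforce
    then have "z = prod_encode (a, b)" by (metis prod_decode_inverse)
    then have z: "z = triangle (a + b) + a" by (simp add: prod_encode_def)
    have "(LEAST s. Suc z - triangle (Suc s) = 0) = a + b"
    proof (rule Least_equality)
      show "Suc z - triangle (Suc (a + b)) = 0" using z by simp
    next
      fix s assume "Suc z - triangle (Suc s) = 0"
      then have "triangle (a + b) < triangle (Suc s)" using z by linarith
      then show "a + b \<le> s" using triangle_mono [of "Suc s" "a + b"] by linarith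
    qed
    then show ?thesis by (simp add: ab)
  qed
  then show ?thesis using rec by simp
qed

lemma recursive1_fst: "recursive1 (\<lambda>z. fst (prod_decode z))"
proof -
  have "fst (prod_decode z) = z - triangle (fst (prod_decode z) + snd (prod_decode z))" for z
  proof -
    obtain a b where "prod_decode z = (a, b)" by fastforce
    moreover from this have "z = prod_encode (a, b)" by (metis prod_decode_inverse)
    ultimately show ?thesis by (simp add: prod_encode_def)
  qed
  then have eq: "(\<lambda>z. fst (prod_decode z))
      = (\<lambda>z. z - triangle (fst (prod_decode z) + snd (prod_decode z)))" by (rule ext)
  show ?thesis
    by (subst eq) (intro recursive1I recursive_diff recursive_triangle
        recursive_comp1 [OF recursive1_diagonal] recursive_arg zero_less_one)
qed

lemmas recursive_fst = recursive_comp1 [OF recursive1_fst]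

lemma recursive1_snd: "recursive1 (\<lambda>z. snd (prod_decode z))"
proof -
  have "snd (prod_decode z) = (fst (prod_decode z) + snd (prod_decode z)) - fst (prod_decode z)" for z
    by simp
  then have eq: "(\<lambda>z. snd (prod_decode z))
      = (\<lambda>z. (fst (prod_decode z) + snd (prod_decode z)) - fst (prod_decode z))" by (rule ext)
  show ?thesis
    by (subst eq) (intro recursive1I recursive_diff recursive_comp1 [OF recursive1_diagonal]
        recursive_fst recursive_arg zero_less_one)
qed

lemmas recursive_snd = recursive_comp1 [OF recursive1_snd]

text \<open>The code of a list is used as a bound on the number of steps for traversing it.\<close>

lemma length_le_list_encode: "length xs \<le> list_encode xs"
proof (induction xs)
  case (Cons x xs)
  then show ?case using le_prod_encode_2 [of "list_encode xs" x] by simp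
qed simp

text \<open>
  A fold is the iteration of a step on pairs of the code of the remaining list and the accumulator.
  The step does nothing once the list is exhausted, so iterating it too often does no harm.
\<close>

lemma recursive2_fold:
  assumes F: "recursive2 F"
  shows "recursive2 (\<lambda>c a. fold F (list_decode c) a)"
proof -
  define rest acc where "rest s = fst (prod_decode s)" and "acc s = snd (prod_decode s)" for s
  define step where "step s = (if rest s = 0 then s else
      prod_encode (snd (prod_decode (rest s - 1)), F (fst (prod_decode (rest s - 1))) (acc s)))" for s
  have step: "recursive1 step"
    unfolding step_def rest_def acc_def
    by (intro recursive1I recursive_if_zero recursive_prod_encode recursive_comp2 [OF F]
        recursive_snd recursive_fst recursive_arith zero_less_one)
  have "rec_nat s (\<lambda>i v. step v) n = (step ^^ n) s" for n s by (induction n) auto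
  moreover have "recursive2 (\<lambda>n s. rec_nat s (\<lambda>i v. step v) n)"
    by (rule recursive2_rec_nat)
      (rule recursive1I recursive3I, intro recursive_comp1 [OF step] recursive_arg; simp)+
  ultimately have iter: "recursive2 (\<lambda>n s. (step ^^ n) s)" by simp
  have run: "(step ^^ n) (prod_encode (list_encode xs, a)) = prod_encode (0, fold F xs a)"
    if "length xs \<le> n" for n xs a
    using that
  proof (induction n arbitrary: xs a)
    case (Suc n)
    have "step (prod_encode (list_encode xs, a)) = (case xs of [] \<Rightarrow> prod_encode (list_encode [], a)
        | x # ys \<Rightarrow> prod_encode (list_encode ys, F x a))"
      by (cases xs) (simp_all add: step_def rest_def acc_def)
    then show ?case
      using Suc.IH [of "tl xs"] Suc.IH [of "[]"] Suc.prems unfolding funpow_Suc_right o_apply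
      by (cases xs) simp_all
  qed simp
  have "fold F (list_decode c) a = acc ((step ^^ c) (prod_encode (c, a)))" for c a
    using run [of "list_decode c" c a] length_le_list_encode [of "list_decode c"]
    by (simp add: acc_def)
  moreover have "recursive2 (\<lambda>c a. acc ((step ^^ c) (prod_encode (c, a))))"
    unfolding acc_def
    by (rule recursive2I)
      (intro recursive_snd recursive_comp2 [OF iter] recursive_prod_encode recursive_arith; simp)
  ultimately show ?thesis by simp
qed

lemma fold_Cons_code:
  "fold (\<lambda>x a. Suc (prod_encode (h x, a))) xs (list_encode ys) = list_encode (rev (map h xs) @ ys)"
proof (induction xs arbitrary: ys)
  case (Cons x xs)
  show ?case using Cons [of "h x # ys"] by simp
qed simp

text \<open>
  Folding from the left with a cons reverses the list, so the reversed image comes first. Mapping,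
  appending an element and deleting the last one then result from operations at the head of a
  reversed list.
\<close>

lemma recursive1_rev_map:
  assumes "recursive1 h"
  shows "recursive1 (\<lambda>c. list_encode (rev (map h (list_decode c))))"
proof -
  have "recursive2 (\<lambda>x a. Suc (prod_encode (h x, a)))"
    by (rule recursive2I)
      (intro recursive_Suc recursive_prod_encode recursive_comp1 [OF assms] recursive_arg; simp)
  note fold = recursive2_fold [OF this]
  have "recursive1 (\<lambda>c. fold (\<lambda>x a. Suc (prod_encode (h x, a))) (list_decode c) 0)"
    by (intro recursive1I recursive_comp2 [OF fold] recursive_arith zero_less_one)
  then show ?thesis
    using fold_Cons_code [of h _ "[]"] by simp
qed

lemma recursive1_rev: "recursive1 (\<lambda>c. list_encode (rev (list_decode c)))"
  using recursive1_rev_map [of "\<lambda>x. x"] by (simp add: recursive1I recursive_arg)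

lemmas recursive_rev = recursive_comp1 [OF recursive1_rev]

lemma recursive1_map:
  assumes "recursive1 h"
  shows "recursive1 (\<lambda>c. list_encode (map h (list_decode c)))"
proof -
  have "recursive1 (\<lambda>c. list_encode (rev (list_decode (list_encode (rev (map h (list_decode c)))))))"
    by (intro recursive1I recursive_rev recursive_comp1 [OF recursive1_rev_map [OF assms]]
        recursive_arg zero_less_one)
  then show ?thesis by simp
qed

lemma recursive1_snoc: "recursive1 (\<lambda>c. list_encode (list_decode c @ [x]))"
proof -
  have "recursive1 (\<lambda>c. list_encode (rev (list_decode
      (Suc (prod_encode (x, list_encode (rev (list_decode c))))))))"
    by (intro recursive1I recursive_rev recursive_prod_encode recursive_arith zero_less_one)
  moreover have "Suc (prod_encode (x, list_encode ys)) = list_encode (x # ys)" for ys by simp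
  ultimately show ?thesis by (simp del: list_encode.simps list_decode.simps)
qed

lemma recursive1_butlast: "recursive1 (\<lambda>c. list_encode (butlast (list_decode c)))"
proof -
  have "prod_decode 0 = (0, 0)"
    using prod_encode_inverse [of "(0, 0)"] by (simp add: prod_encode_def)
  then have tl: "snd (prod_decode (list_encode xs - 1)) = list_encode (tl xs)" for xs
    by (cases xs) simp_all
  have "recursive1 (\<lambda>c. list_encode (rev (list_decode
      (snd (prod_decode (list_encode (rev (list_decode c)) - 1))))))"
    by (intro recursive1I recursive_rev recursive_snd recursive_arith zero_less_one)
  then show ?thesis by (simp only: tl list_encode_inverse butlast_rev [symmetric] rev_rev_ident)
qed


section \<open>Universal machines\<close>

text \<open>The constant is the length of the self-delimiting prefix that names \<open>M\<close>.\<close>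

lemma universal_simulation:
  assumes "recursive_enumeration A" and "universal A U" and "partial_recursive M"
  obtains c where "\<And>p. \<exists>q. U q = M p \<and> length q = length p + c"
proof -
  obtain m where "m \<ge> 1" "A m = M"
    using assms(1,3) unfolding recursive_enumeration_def by (metis (mono_tags) atLeast_iff imageE mem_Collect_eq)
  then have "U (hat (inv str_code m) @ p) = M p" for p
    using assms(2) by (simp add: universal_def)
  then show ?thesis
    by (intro that [of "length (hat (inv str_code m))"]) (metis add.commute length_append)
qed

lemma universal_surj:
  assumes "recursive_enumeration A" and "universal A U"
  shows "\<exists>p. U p = Some s"
proof -
  have "partial_recursive Some"
    unfolding partial_recursive_def by (rule exI [of _ "Proj 0"]) simp
  then show ?thesis by (metis universal_simulation [OF assms])
qed

lemma str_code_inverse [simp]: "str_code (inv str_code n) = n" "inv str_code (str_code s) = s"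
  using bij_str_code by (simp_all add: bij_is_surj surj_f_inv_f bij_is_inj)

text \<open>
  Composing \<open>U\<close> with \<open>F\<close> gives a machine, and \<open>U\<close> simulates that machine at constant cost. All
  comparisons of program lengths go through this lemma.
\<close>

lemma universal_postprocess:
  assumes "recursive_enumeration A" and "universal A U" and "recursive1 F"
  obtains c where "\<And>p s. U p = Some s \<Longrightarrow>
    \<exists>q. U q = Some (inv str_code (F (str_code s))) \<and> length q = length p + c"
proof -
  define M where "M p = map_option (\<lambda>s. inv str_code (F (str_code s))) (U p)" for p
  obtain u where u: "\<forall>p. pr_eval u [str_code p] = map_option str_code (U p)"
    using assms(2) by (auto simp: universal_def partial_recursive_def)
  obtain r where r: "\<forall>x. pr_eval r [x] = Some (F x)"
    using assms(3) recursive1_def by auto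
  have "pr_eval (Comp r [u]) [str_code p] = map_option str_code (M p)" for p
    by (cases "U p") (simp_all add: u r M_def)
  then have "partial_recursive M" unfolding partial_recursive_def by blast
  from universal_simulation [OF assms(1,2) this] obtain c
    where "\<And>p. \<exists>q. U q = M p \<and> length q = length p + c" by blast
  then show ?thesis by (intro that [of c]) (metis M_def option.simps(9))
qed

lemma AIC_attained:
  assumes "recursive_enumeration A" and "universal A U"
  obtains p where "U p = Some s" and "length p = AIC U s"
proof -
  have "\<exists>k p. U p = Some s \<and> k = length p" using universal_surj [OF assms] by blast
  then have "\<exists>p. U p = Some s \<and> AIC U s = length p" unfolding AIC_def by (rule LeastI_ex)
  then show ?thesis using that by metis
qed

lemma AIC_le: "U p = Some s \<Longrightarrow> AIC U s \<le> length p"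
  unfolding AIC_def by (rule Least_le) blast


section \<open>Recursive coding of words and point lists\<close>

lemma recursive1_listing_inverse:
  assumes "recursive_listing Q" and "surj Q"
  obtains h where "recursive1 h"
    and "\<And>ss. Q (inv str_code (h (list_encode (map str_code ss)))) = ss"
proof -
  define g where "g x = list_encode (map str_code (Q (inv str_code x)))" for x
  obtain r where "\<forall>s. pr_eval r [str_code s] = Some (list_encode (map str_code (Q s)))"
    using assms(1) recursive_listing_def by auto
  from spec [OF this, of "inv str_code _"] have "recursive1 g"
    unfolding recursive1_def g_def by auto
  moreover have "surj g"
  proof (rule surjI)
    fix z
    define s where "s = (SOME s. Q s = map (inv str_code) (list_decode z))"
    have "Q s = map (inv str_code) (list_decode z)"
      unfolding s_def using assms(2) by (metis (mono_tags) someI_ex surj_def)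
    then show "g (str_code (SOME s. Q s = map (inv str_code) (list_decode z))) = z"
      by (simp add: g_def o_def flip: s_def)
  qed
  ultimately obtain h where h: "recursive1 h" "\<And>z. g (h z) = z"
    by (rule recursive1_inverse) blast
  have "Q (inv str_code (h (list_encode (map str_code ss)))) = ss" for ss
    using h(2) [of "list_encode (map str_code ss)"] bij_str_code
    by (simp add: g_def list_encode_eq inj_map_eq_map bij_is_inj)
  with h(1) that show ?thesis by blast
qed

text \<open>
  An encoding of words over \<open>{0, \<dots>, N - 1}\<close> is controlled only on such words and may diverge
  elsewhere, which would block a search for preimages. Replacing each entry \<open>x\<close> by its minimum with
  \<open>N - 1\<close>, written with truncated subtraction, makes every list a word and fixes the words.
\<close>

definition clip :: "nat \<Rightarrow> nat \<Rightarrow> nat" where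
  "clip N c = list_encode (map (\<lambda>x. x - (x - (N - 1))) (list_decode c))"

lemma recursive1_clip: "recursive1 (clip N)"
  unfolding clip_def by (intro recursive1_map recursive1I recursive_arith zero_less_one)

lemma clip_word: "w \<in> words N \<Longrightarrow> clip N (list_encode w) = list_encode w"
  unfolding clip_def words_def by (force simp: list_encode_eq intro!: map_idI)

lemma clip_in_words: "N \<ge> 1 \<Longrightarrow> list_decode (clip N c) \<in> words N"
  unfolding clip_def words_def by auto

lemma recursive1_word_encoder:
  assumes "word_encoding enc" and "N \<ge> 1"
  shows "recursive1 (\<lambda>c. str_code (enc N (list_decode (clip N c))))"
proof -
  obtain r where "\<forall>w\<in>words N. pr_eval r [list_encode w] = Some (str_code (enc N w))"
    using assms unfolding word_encoding_def by blast
  from bspec [OF this clip_in_words [OF assms(2)]]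
  have r: "pr_eval r [clip N c] = Some (str_code (enc N (list_decode (clip N c))))" for c by simp
  obtain t where "\<forall>c. pr_eval t [c] = Some (clip N c)"
    using recursive1_clip [of N] unfolding recursive1_def by blast
  then show ?thesis
    unfolding recursive1_def by (intro exI [of _ "Comp r [t]"]) (simp add: r)
qed

text \<open>
  Composed with \<open>clip\<close> the encoding is total and still onto, so it can be inverted by search.
  Distinct lists may have the same clipped form; clipping the preimage found recovers the word.
\<close>

lemma recursive1_word_decoder:
  assumes "word_encoding enc" and "N \<ge> 1"
  obtains h where "recursive1 h" and "\<And>w. w \<in> words N \<Longrightarrow> h (str_code (enc N w)) = list_encode w"
proof -
  let ?g = "\<lambda>c. str_code (enc N (list_decode (clip N c)))"
  have bij: "bij_betw (enc N) (words N) UNIV"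
    using assms unfolding word_encoding_def by blast
  have "surj ?g"
  proof (rule surjI)
    fix z
    let ?w = "inv_into (words N) (enc N) (inv str_code z)"
    have "?w \<in> words N" and "enc N ?w = inv str_code z"
      using bij by (auto simp: bij_betw_def intro: inv_into_into f_inv_into_f)
    then show "?g (list_encode ?w) = z" by (simp add: clip_word)
  qed
  with recursive1_word_encoder [OF assms] obtain h where h: "recursive1 h" "\<And>z. ?g (h z) = z"
    by (rule recursive1_inverse) blast
  have "recursive1 (\<lambda>z. clip N (h z))"
    by (intro recursive1I recursive_comp1 [OF recursive1_clip] recursive_comp1 [OF h(1)]
        recursive_arg zero_less_one)
  moreover have "clip N (h (str_code (enc N w))) = list_encode w" if "w \<in> words N" for w
  proof -
    have "enc N (list_decode (clip N (h (str_code (enc N w))))) = enc N w"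
      using h(2) [of "str_code (enc N w)"] bij_str_code by (simp add: bij_is_inj inj_eq)
    then have "list_decode (clip N (h (str_code (enc N w)))) = w"
      using bij that clip_in_words [OF assms(2)] by (auto simp: bij_betw_def inj_on_eq_iff)
    then show ?thesis by (metis list_decode_inverse)
  qed
  ultimately show ?thesis using that by blast
qed


section \<open>Deciding nearness\<close>

text \<open>
  Comparing the coded numerator with the denominator decides smallness well enough. The code of an
  integer \<open>a\<close> is \<open>2 * a\<close> for \<open>a \<ge> 0\<close> and \<open>- 2 * a - 1\<close> for \<open>a < 0\<close>, so it is at most
  \<open>2 * \<bar>a\<bar>\<close> and at least \<open>2 * a\<close>. Hence one test, without decoding the sign, succeeds for
  all rationals of small absolute value and only for rationals below the threshold.
\<close>

lemma rat_code_threshold: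
  fixes q :: rat and c :: nat
  assumes "c \<ge> 1"
  defines "z \<equiv> prod_decode (rat_code q)"
  shows "\<bar>of_rat q :: real\<bar> < 1 / (2 * real c) \<Longrightarrow> fst z * c < snd z"
    and "fst z * c < snd z \<Longrightarrow> (of_rat q :: real) < 1 / (2 * real c)"
proof -
  obtain a b where ab: "quotient_of q = (a, b)" by fastforce
  then have b: "b > 0" by (rule quotient_of_denom_pos)
  have "q = of_int a / of_int b" using ab by (rule quotient_of_div)
  then have q: "(of_rat q :: real) = a / b" by (simp add: of_rat_divide)
  have z: "fst z = int_encode a" "snd z = nat b"
    using ab by (simp_all add: z_def rat_code_def)
  have le: "int (int_encode a) \<le> 2 * \<bar>a\<bar>" "2 * a \<le> int (int_encode a)"
    by (auto simp: int_encode_def sum_encode_def)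
  have iff: "x / b < 1 / (2 * real c) \<longleftrightarrow> x * 2 * c < b" for x :: int
  proof -
    have "real_of_int x / b < 1 / (2 * real c) \<longleftrightarrow> real_of_int (x * 2 * int c) < real_of_int b"
      using b assms(1) by (simp add: field_simps)
    then show ?thesis by linarith
  qed
  show "fst z * c < snd z" if "\<bar>of_rat q :: real\<bar> < 1 / (2 * real c)"
  proof -
    have "\<bar>a\<bar> * 2 * c < b" using that b by (simp add: q abs_divide flip: iff)
    moreover have "int (int_encode a) * c \<le> 2 * \<bar>a\<bar> * c" using le(1) by (intro mult_right_mono) auto
    ultimately have "int (int_encode a * c) < b" by (simp add: mult.commute mult.left_commute)
    then show ?thesis unfolding z by linarith
  qed
  show "(of_rat q :: real) < 1 / (2 * real c)" if "fst z * c < snd z"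
  proof -
    have "int (int_encode a * c) < b" using that unfolding z by linarith
    moreover have "2 * a * c \<le> int (int_encode a) * c" using le(2) by (intro mult_right_mono) auto
    ultimately have "a * 2 * c < b" by (simp add: mult.commute mult.left_commute)
    then show ?thesis unfolding q iff .
  qed
qed

text \<open>
  Whether \<open>dist (I s) (I t) < \<delta>\<close> holds need not be decidable, but a recursive test can separate
  distances below a smaller \<open>\<eta>\<close> from distances of at least \<open>\<delta>\<close>. It is essential that \<open>\<eta>\<close> depends
  on \<open>\<delta>\<close> alone: the list \<open>ts\<close> will be a net of mesh \<open>\<eta>\<close>.
\<close>

lemma recursive1_near_center:
  fixes I :: "str \<Rightarrow> 'a::metric_space"
  assumes "computable_interpretation I" and "\<delta> > 0"
  obtains \<eta> where "0 < \<eta>" and "\<eta> < \<delta>"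
    and "\<And>ts lab. \<exists>h. recursive1 h \<and> (\<forall>s. (\<exists>t\<in>set ts. dist (I s) (I t) < \<eta>) \<longrightarrow>
           (\<exists>t\<in>set ts. dist (I s) (I t) < \<delta> \<and> h (str_code s) = lab t))"
proof -
  obtain D where D: "recursive_approx D"
    and approx: "\<And>s t n. \<bar>dist (I s) (I t) - of_rat (D s t n)\<bar> \<le> 1 / 2 ^ n"
    using assms(1) unfolding computable_interpretation_def mutually_computable_def by blast
  obtain r where r: "\<And>s t n. pr_eval r [str_code s, str_code t, n] = Some (rat_code (D s t n))"
    using D unfolding recursive_approx_def by blast
  obtain c :: nat where c: "c \<ge> 1" "1 / c < \<delta>"
  proof -
    obtain k where "inverse (real (Suc k)) < \<delta>" using reals_Archimedean [OF assms(2)] by blast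
    then show ?thesis by (intro that [of "Suc k"]) (auto simp: field_simps)
  qed
  \<comment> \<open>The test compares approximate distances with \<open>\<theta>\<close>. The approximations err by less than
      \<open>\<theta> / 2\<close>, so distances below \<open>\<theta> / 2\<close> pass and all that pass are below
      \<open>3 * \<theta> / 2\<close>.\<close>
  define \<theta> where "\<theta> = 1 / (2 * real c)"
  have \<theta>: "\<theta> > 0" "2 * \<theta> < \<delta>" using c by (simp_all add: \<theta>_def)
  obtain m where m: "(1 / 2) ^ m < \<theta> / 2"
    using real_arch_pow_inv [of "\<theta> / 2" "1 / 2"] \<theta>(1) by auto
  then have err: "\<bar>dist (I s) (I t) - of_rat (D s t m)\<bar> < \<theta> / 2" for s t
    using approx [of s t m] by (simp add: power_one_over)
  \<comment> \<open>A strict inequality of naturals as the vanishing of a truncated difference.\<close>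
  define P where "P t x =
      Suc (fst (prod_decode (rat_code (D (inv str_code x) t m))) * c)
      - snd (prod_decode (rat_code (D (inv str_code x) t m)))" for t x
  have "recursive3 (\<lambda>x y n. rat_code (D (inv str_code x) (inv str_code y) n))"
    unfolding recursive3_def
    by (intro exI [of _ r]) (metis r str_code_inverse(1))
  then have *: "recursive1 (\<lambda>x. rat_code (D (inv str_code x) (inv str_code y) m))" for y
    by (intro recursive1I) (erule recursive_comp3; intro recursive_arith zero_less_one)
  have rec: "recursive1 (P t)" for t
    unfolding P_def
    by (intro recursive1I recursive_fst recursive_snd recursive_arith
        recursive_comp1 [OF * [of "str_code t", simplified]] zero_less_one)
  have P: "P t (str_code s) = 0 \<longleftrightarrow> fst (prod_decode (rat_code (D s t m))) * c
      < snd (prod_decode (rat_code (D s t m)))" for s t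
    by (auto simp: P_def)
  have P1: "P t (str_code s) = 0" if "dist (I s) (I t) < \<theta> / 2" for s t
  proof -
    have "\<bar>of_rat (D s t m) :: real\<bar> < \<theta>"
      using err [of s t] that zero_le_dist [of "I s" "I t"] by linarith
    then show ?thesis unfolding P \<theta>_def by (rule rat_code_threshold(1) [OF c(1)])
  qed
  have P2: "dist (I s) (I t) < \<delta>" if "P t (str_code s) = 0" for s t
  proof -
    have "of_rat (D s t m) < \<theta>"
      using that unfolding P \<theta>_def by (rule rat_code_threshold(2) [OF c(1)])
    then show ?thesis using err [of s t] \<theta> by linarith
  qed
  show ?thesis
  proof (rule that)
    show "0 < \<theta> / 2" "\<theta> / 2 < \<delta>" using \<theta> by simp_all
  next
    fix ts :: "str list" and lab :: "str \<Rightarrow> nat"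
    obtain h where "recursive1 h"
      "\<And>x. \<exists>t\<in>set ts. P t x = 0 \<Longrightarrow> \<exists>t\<in>set ts. P t x = 0 \<and> h x = lab t"
      using recursive1_finite_choice [of ts P lab] rec by blast
    then show "\<exists>h. recursive1 h \<and> (\<forall>s. (\<exists>t\<in>set ts. dist (I s) (I t) < \<theta> / 2) \<longrightarrow>
           (\<exists>t\<in>set ts. dist (I s) (I t) < \<delta> \<and> h (str_code s) = lab t))"
      by (intro exI [of _ h]) (meson P1 P2)
  qed
qed

lemma finite_net:
  fixes I :: "str \<Rightarrow> 'a::metric_space"
  assumes "compact (UNIV :: 'a set)" and "computable_interpretation I" and "\<epsilon> > 0"
  obtains ts where "\<And>x. \<exists>t\<in>set ts. dist (I t) x < \<epsilon>"
proof -
  have "x \<in> (\<Union>t. ball (I t) \<epsilon>)" for x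
  proof -
    have "x \<in> closure (range I)" using assms(2) by (simp add: computable_interpretation_def)
    then show ?thesis using assms(3) by (auto simp: closure_approachable)
  qed
  then have "UNIV \<subseteq> (\<Union>t\<in>UNIV. ball (I t) \<epsilon>)" by blast
  from compactE_image [OF assms(1) _ this]
  obtain C where "finite C" "UNIV \<subseteq> (\<Union>t\<in>C. ball (I t) \<epsilon>)" by (metis open_ball)
  moreover obtain ts where "set ts = C" using \<open>finite C\<close> finite_list by blast
  ultimately have "\<exists>t\<in>set ts. x \<in> ball (I t) \<epsilon>" for x by blast
  then show ?thesis by (intro that [of ts]) simp
qed


section \<open>Shadowing programs\<close>

lemma shadow_length_le:
  assumes "U p = Some s" and "length (Q s) = n + 1"
    and "\<And>i. i \<le> n \<Longrightarrow> dist (I (Q s ! i)) ((T ^^ i) x) < \<epsilon>"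
  shows "shadow_length U Q I T x n \<epsilon> \<le> length p"
  unfolding shadow_length_def
proof (rule Least_le, intro exI conjI)
  show "point_output U Q I p = Some (map I (Q s))" using assms(1) by (simp add: point_output_def)
  show "(MAX i\<in>{0..n}. dist (map I (Q s) ! i) ((T ^^ i) x)) < \<epsilon>"
    using assms by (subst Max_less_iff) auto
qed (simp_all add: assms(2))

text \<open>
  The defining minimum ranges over a nonempty set: by density every orbit segment is shadowed by a
  list of ideal points, \<open>Q\<close> reaches this list, and \<open>U\<close> outputs every string.
\<close>

lemma shadow_length_attained:
  fixes I :: "str \<Rightarrow> 'a::metric_space"
  assumes "recursive_enumeration A" and "universal A U" and "surj Q"
    and "computable_interpretation I" and "\<epsilon> > 0"
  obtains p s where "U p = Some s" and "length (Q s) = n + 1"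
    and "\<And>i. i \<le> n \<Longrightarrow> dist (I (Q s ! i)) ((T ^^ i) x) < \<epsilon>"
    and "length p = shadow_length U Q I T x n \<epsilon>"
proof -
  let ?R = "\<lambda>k. \<exists>p ys. point_output U Q I p = Some ys \<and> length ys = n + 1 \<and>
        (MAX i\<in>{0..n}. dist (ys ! i) ((T ^^ i) x)) < \<epsilon> \<and> k = length p"
  have "\<exists>t. dist (I t) y < \<epsilon>" for y
  proof -
    have "y \<in> closure (range I)" using assms(4) by (simp add: computable_interpretation_def)
    then show ?thesis using assms(5) by (auto simp: closure_approachable)
  qed
  then obtain g where g: "\<And>y. dist (I (g y)) y < \<epsilon>" by metis
  obtain s where s: "Q s = map (\<lambda>i. g ((T ^^ i) x)) [0..<n + 1]" using assms(3) by (metis surj_def)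
  obtain p where p: "U p = Some s" using universal_surj [OF assms(1,2)] by blast
  have "(MAX i\<in>{0..n}. dist (map I (Q s) ! i) ((T ^^ i) x)) < \<epsilon>"
    using g by (subst Max_less_iff) (auto simp: s simp del: upt_Suc)
  then have "?R (length p)"
    by (intro exI [of _ p] exI [of _ "map I (Q s)"]) (simp add: point_output_def p s)
  then have "?R (shadow_length U Q I T x n \<epsilon>)" unfolding shadow_length_def by (rule LeastI)
  then obtain p s where *: "U p = Some s" "length (Q s) = n + 1"
    "(MAX i\<in>{0..n}. dist (map I (Q s) ! i) ((T ^^ i) x)) < \<epsilon>"
    "length p = shadow_length U Q I T x n \<epsilon>"
    by (auto simp: point_output_def)
  have "dist (I (Q s ! i)) ((T ^^ i) x) < \<epsilon>" if "i \<le> n" for i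
    using *(3) that *(2) by (subst (asm) Max_less_iff) auto
  with * that show ?thesis by blast
qed


section \<open>Comparison of the two complexities\<close>

text \<open>
  The cover consists of the balls of radius \<open>\<epsilon>\<close> around a finite net. The first \<open>n\<close> symbols of an
  itinerary determine all points of a shadowing list but the last; the function \<open>F j\<close> appends \<open>j\<close>
  to the word before passing to centres.
\<close>

lemma shadow_length_le_itinerary:
  fixes I :: "str \<Rightarrow> 'a::metric_space"
  assumes "recursive_enumeration A" and "universal A U" and "word_encoding enc"
    and "recursive_listing Q" and "surj Q" and "compact (UNIV :: 'a set)"
    and "computable_interpretation I" and "\<epsilon> > 0"
  obtains B c where "open_cover B"
    and "\<And>n \<omega>. \<omega> \<in> itineraries T B x \<Longrightarrow>
      shadow_length U Q I T x n \<epsilon> \<le> AIC_word U enc (length B) (map \<omega> [0..<n]) + c"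
proof -
  obtain ts where ts: "\<And>x. \<exists>t\<in>set ts. dist (I t) x < \<epsilon>" using finite_net assms(6-8) by blast
  define N where "N = length ts"
  define B where "B = map (\<lambda>t. ball (I t) \<epsilon>) ts"
  have "ts \<noteq> []" using ts by fastforce
  then have N: "N \<ge> 1" by (simp add: N_def Suc_leI)
  have len: "length B = N" by (simp add: B_def N_def)
  have cover: "open_cover B" using ts by (auto simp: open_cover_def B_def)
  obtain d where d: "recursive1 d" "\<And>w. w \<in> words N \<Longrightarrow> d (str_code (enc N w)) = list_encode w"
    using recursive1_word_decoder [OF assms(3) N] by blast
  obtain l where l: "recursive1 l" "\<And>ss. Q (inv str_code (l (list_encode (map str_code ss)))) = ss"
    using recursive1_listing_inverse [OF assms(4,5)] by blast
  define P where "P j x = (x - j) + (j - x)" for j x :: nat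
  have "recursive1 (P j)" for j
    unfolding P_def by (intro recursive1I recursive_arith zero_less_one)
  then obtain h where h: "recursive1 h"
    "\<And>x. \<exists>j\<in>set [0..<N]. P j x = 0 \<Longrightarrow> \<exists>j\<in>set [0..<N]. P j x = 0 \<and> h x = str_code (ts ! j)"
    using recursive1_finite_choice [of "[0..<N]" P "\<lambda>j. str_code (ts ! j)"] by blast
  have h': "h j = str_code (ts ! j)" if "j < N" for j
  proof -
    have "\<exists>i\<in>set [0..<N]. P i j = 0" by (rule bexI [of _ j]) (simp_all add: that P_def)
    from h(2) [OF this] obtain i where "P i j = 0" "h j = str_code (ts ! i)" by blast
    moreover from this have "i = j" by (simp add: P_def)
    ultimately show ?thesis by simp
  qed
  define F where "F j z = l (list_encode (map h (list_decode
      (list_encode (list_decode (d z) @ [j])))))" for j z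
  have F: "recursive1 (F j)" for j
    unfolding F_def
    by (intro recursive1I recursive_comp1 [OF l(1)] recursive_comp1 [OF recursive1_map [OF h(1)]]
        recursive_comp1 [OF recursive1_snoc] recursive_comp1 [OF d(1)] recursive_arg zero_less_one)
  \<comment> \<open>The constant depends on the last symbol; the sum over the alphabet serves for all symbols.\<close>
  have "\<forall>j. \<exists>c. \<forall>p s. U p = Some s \<longrightarrow>
      (\<exists>q. U q = Some (inv str_code (F j (str_code s))) \<and> length q = length p + c)"
    using universal_postprocess [OF assms(1,2) F] by metis
  then obtain C where C: "\<And>j p s. U p = Some s \<Longrightarrow>
      \<exists>q. U q = Some (inv str_code (F j (str_code s))) \<and> length q = length p + C j" by metis
  have "shadow_length U Q I T x n \<epsilon> \<le> AIC_word U enc (length B) (map \<omega> [0..<n]) + (\<Sum>j<N. C j)"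
    if \<omega>: "\<omega> \<in> itineraries T B x" for n \<omega>
  proof -
    have lt: "\<omega> i < N" and "(T ^^ i) x \<in> B ! \<omega> i" for i
      using \<omega> by (auto simp: itineraries_def len)
    then have near: "dist (I (ts ! \<omega> i)) ((T ^^ i) x) < \<epsilon>" for i
      by (simp add: B_def N_def)
    let ?w = "map \<omega> [0..<n]"
    have w: "?w \<in> words N" using lt by (auto simp: words_def)
    obtain p where p: "U p = Some (enc N ?w)" "length p = AIC_word U enc N ?w"
      using AIC_attained [OF assms(1,2)] unfolding AIC_word_def by metis
    define s where "s = inv str_code (F (\<omega> n) (str_code (enc N ?w)))"
    obtain q where q: "U q = Some s" "length q = length p + C (\<omega> n)"
      using C [OF p(1)] s_def by metis
    have "map h (?w @ [\<omega> n]) = map str_code (map (\<lambda>i. ts ! \<omega> i) [0..<n + 1])"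
      using lt by (simp add: h')
    then have Qs: "Q s = map (\<lambda>i. ts ! \<omega> i) [0..<n + 1]"
      unfolding s_def F_def d(2) [OF w] list_encode_inverse by (simp only: l(2))
    have "shadow_length U Q I T x n \<epsilon> \<le> length q"
    proof (rule shadow_length_le [where U = U and p = q, OF q(1)])
      fix i assume "i \<le> n"
      then show "dist (I (Q s ! i)) ((T ^^ i) x) < \<epsilon>"
        using near [of i] unfolding Qs by (subst nth_map) (auto simp del: upt_Suc)
    qed (simp add: Qs)
    also have "\<dots> \<le> AIC_word U enc N ?w + (\<Sum>j<N. C j)"
      using q(2) p(2) member_le_sum [of "\<omega> n" "{..<N}" C] lt by simp
    finally show ?thesis by (simp add: len)
  qed
  with cover that show ?thesis by blast
qed

text \<open>
  The symbol read off from a string \<open>s\<close> is correct for every point \<open>y\<close> within \<open>\<eta>\<close> of \<open>I s\<close>: the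
  net point \<open>I t\<close> selected for \<open>s\<close> is within \<open>e / 2\<close> of \<open>I s\<close> and \<open>\<eta> < e / 2\<close>, so \<open>y\<close> lies in
  the ball of radius \<open>e\<close> around \<open>I t\<close>, hence in the assigned member of the cover.
\<close>

lemma itinerary_le_shadow_length:
  fixes I :: "str \<Rightarrow> 'a::metric_space"
  assumes "recursive_enumeration A" and "universal A U" and "word_encoding enc"
    and "recursive_listing Q" and "surj Q" and "compact (UNIV :: 'a set)"
    and "computable_interpretation I" and "open_cover B"
  obtains \<epsilon> c where "\<epsilon> > 0"
    and "\<And>n. \<exists>\<omega>\<in>itineraries T B x.
      AIC_word U enc (length B) (map \<omega> [0..<n]) \<le> shadow_length U Q I T x n \<epsilon> + c"
proof -
  define N where "N = length B"
  have "\<Union> (set B) = UNIV" and op: "\<And>V. V \<in> set B \<Longrightarrow> open V"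
    using assms(8) by (auto simp: open_cover_def)
  then obtain e where e: "e > 0" "\<And>y. \<exists>V\<in>set B. ball y e \<subseteq> V"
    using Heine_Borel_lemma [OF assms(6), of "set B"] by (metis UNIV_I order_refl)
  then have "\<exists>j<N. ball y e \<subseteq> B ! j" for y
    unfolding N_def by (metis in_set_conv_nth)
  then obtain J where J: "\<And>y. J y < N" "\<And>y. ball y e \<subseteq> B ! J y" by metis
  have N: "N \<ge> 1" using J(1) by (metis less_one not_less not_less_zero)
  have "e / 2 > 0" using e(1) by simp
  from recursive1_near_center [OF assms(7) this] obtain \<eta>
    where \<eta>: "0 < \<eta>" "\<eta> < e / 2"
    and near: "\<And>ts lab. \<exists>h. recursive1 h \<and> (\<forall>s. (\<exists>t\<in>set ts. dist (I s) (I t) < \<eta>) \<longrightarrow>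
           (\<exists>t\<in>set ts. dist (I s) (I t) < e / 2 \<and> h (str_code s) = lab t))" by blast
  obtain ts where ts: "\<And>x. \<exists>t\<in>set ts. dist (I t) x < \<eta>" using finite_net assms(6,7) \<eta>(1) by blast
  obtain h where h: "recursive1 h"
    "\<And>s. \<exists>t\<in>set ts. dist (I s) (I t) < \<eta> \<Longrightarrow>
           \<exists>t\<in>set ts. dist (I s) (I t) < e / 2 \<and> h (str_code s) = J (I t)"
    using near [of ts "\<lambda>t. J (I t)"] by blast
  have hN: "h (str_code s) < N" and hB: "dist (I s) y < \<eta> \<Longrightarrow> y \<in> B ! h (str_code s)" for s y
  proof -
    obtain t where t: "dist (I s) (I t) < e / 2" "h (str_code s) = J (I t)"
      using h(2) [of s] ts [of "I s"] by (auto simp: dist_commute)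
    then show "h (str_code s) < N" by (simp add: J(1))
    assume "dist (I s) y < \<eta>"
    then have "dist (I t) y < e"
      using t(1) \<eta>(2) dist_triangle [of "I t" y "I s"] by (simp add: dist_commute)
    then have "y \<in> ball (I t) e" by simp
    then show "y \<in> B ! h (str_code s)" using J(2) [of "I t"] t(2) by auto
  qed
  define g where "g c = str_code (enc N (list_decode (clip N c)))" for c
  have g: "recursive1 g" unfolding g_def using recursive1_word_encoder [OF assms(3) N] .
  obtain r where r: "\<forall>s. pr_eval r [str_code s] = Some (list_encode (map str_code (Q s)))"
    using assms(4) recursive_listing_def by auto
  then have Q: "recursive1 (\<lambda>z. list_encode (map str_code (Q (inv str_code z))))"
    unfolding recursive1_def by (metis str_code_inverse(1))
  define F where "F z = g (list_encode (butlast (list_decode (list_encode (map h (list_decode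
      (list_encode (map str_code (Q (inv str_code z))))))))))" for z
  have F: "recursive1 F"
    unfolding F_def
    by (intro recursive1I recursive_comp1 [OF g] recursive_comp1 [OF recursive1_butlast]
        recursive_comp1 [OF recursive1_map [OF h(1)]] recursive_comp1 [OF Q]
        recursive_arg zero_less_one)
  obtain c where c: "\<And>p s. U p = Some s \<Longrightarrow>
      \<exists>q. U q = Some (inv str_code (F (str_code s))) \<and> length q = length p + c"
    using universal_postprocess [OF assms(1,2) F] by blast
  have "\<exists>\<omega>\<in>itineraries T B x.
      AIC_word U enc N (map \<omega> [0..<n]) \<le> shadow_length U Q I T x n \<eta> + c" for n
  proof -
    obtain p s where p: "U p = Some s" and lenQ: "length (Q s) = n + 1"
      and close: "\<And>i. i \<le> n \<Longrightarrow> dist (I (Q s ! i)) ((T ^^ i) x) < \<eta>"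
      and lenp: "length p = shadow_length U Q I T x n \<eta>"
      using shadow_length_attained [OF assms(1,2,5,7) \<eta>(1)] by metis
    \<comment> \<open>Only the first \<open>n\<close> symbols are computed; beyond them any continuation will do.\<close>
    define \<omega> where "\<omega> i = (if i < n then h (str_code (Q s ! i)) else J ((T ^^ i) x))" for i
    have "\<omega> \<in> itineraries T B x"
    proof -
      have "(T ^^ i) x \<in> B ! \<omega> i" for i
        using hB [OF close [of i]] J(2) [of "(T ^^ i) x"] e(1) by (auto simp: \<omega>_def)
      then show ?thesis using hN J(1) by (auto simp: itineraries_def \<omega>_def N_def)
    qed
    moreover have "AIC_word U enc N (map \<omega> [0..<n]) \<le> length p + c"
    proof -
      have w: "butlast (map h (map str_code (Q s))) = map \<omega> [0..<n]"
        by (rule nth_equalityI) (auto simp: lenQ nth_butlast \<omega>_def)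
      have "map \<omega> [0..<n] \<in> words N" using hN by (auto simp: words_def \<omega>_def)
      then have "F (str_code s) = str_code (enc N (map \<omega> [0..<n]))"
        by (simp add: F_def g_def w clip_word del: map_map)
      then obtain q where "U q = Some (enc N (map \<omega> [0..<n]))" "length q = length p + c"
        using c [OF p] by auto
      then show ?thesis unfolding AIC_word_def by (metis AIC_le)
    qed
    ultimately show ?thesis using lenp by auto
  qed
  with \<eta>(1) that show ?thesis unfolding N_def by blast
qed

text \<open>
  An additive constant in the program length vanishes after division by \<open>f\<close>. Only those \<open>n\<close> with
  \<open>f n > 0\<close> are considered, since for negative \<open>f n\<close> the division reverses inequalities.
\<close>

lemma limsup_le_of_bounded_difference:
  fixes u v :: "nat \<Rightarrow> ereal" and f :: "nat \<Rightarrow> real"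
  assumes "filterlim f at_top sequentially"
    and "\<And>n. f n > 0 \<Longrightarrow> u n \<le> ereal (c / f n) + v n"
  shows "limsup u \<le> limsup v"
proof -
  have "(\<lambda>n. c / f n) \<longlonglongrightarrow> 0"
    using assms(1) by (intro real_tendsto_divide_at_top [OF tendsto_const])
  then have lim: "(\<lambda>n. ereal (c / f n)) \<longlonglongrightarrow> 0" by (simp add: zero_ereal_def)
  have "eventually (\<lambda>n. f n > 0) sequentially"
    using assms(1) by (simp add: filterlim_at_top_dense)
  then have "limsup u \<le> limsup (\<lambda>n. ereal (c / f n) + v n)"
    by (intro Limsup_mono) (auto elim: eventually_mono intro: assms(2))
  also have "\<dots> = limsup v"
    using ereal_limsup_lim_add [OF lim] by simp
  finally show ?thesis .
qed

theorem theorem20: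
  fixes A :: "nat \<Rightarrow> machine" and U :: machine
    and enc :: "nat \<Rightarrow> nat list \<Rightarrow> str" and Q :: "str \<Rightarrow> str list"
    and S :: "(str \<Rightarrow> 'a::metric_space) set" and T :: "'a \<Rightarrow> 'a" and f :: "nat \<Rightarrow> real"
  assumes "recursive_enumeration A" and "universal A U"
    and "word_encoding enc"
    and "recursive_listing Q" and "surj Q"
    and "computable_structure S"
    and "continuous_on UNIV T"
    and "mono f" and "filterlim f at_top sequentially"
    and "compact (UNIV :: 'a set)"
  shows "\<forall>I :: str \<Rightarrow> 'a. computable_interpretation I \<longrightarrow>
           (\<forall>x. shadow_complexity U Q I f T x = orbit_complexity U enc f T x)"
proof (intro allI impI antisym)
  fix I :: "str \<Rightarrow> 'a" and x :: 'a
  assume I: "computable_interpretation I"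
  show "shadow_complexity U Q I f T x \<le> orbit_complexity U enc f T x"
    unfolding shadow_complexity_def
  proof (rule SUP_least)
    fix \<epsilon> :: real assume "\<epsilon> \<in> {0<..}"
    then have "\<epsilon> > 0" by simp
    from shadow_length_le_itinerary [OF assms(1-5,10) I this]
    obtain B c where B: "open_cover B" and le: "\<And>n \<omega>. \<omega> \<in> itineraries T B x \<Longrightarrow>
      shadow_length U Q I T x n \<epsilon> \<le> AIC_word U enc (length B) (map \<omega> [0..<n]) + c" by blast
    have "shadow_complexity_at U Q I f T x \<epsilon> \<le> cover_complexity U enc f T B x"
      unfolding shadow_complexity_at_def cover_complexity_def
    proof (rule limsup_le_of_bounded_difference [OF assms(9)])
      fix n assume f: "f n > 0"
      let ?K = "real (shadow_length U Q I T x n \<epsilon>)"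
      let ?L = "INF \<omega>\<in>itineraries T B x.
        ereal (real (AIC_word U enc (length B) (map \<omega> [0..<n])) / f n)"
      have "ereal (?K / f n - real c / f n) \<le> ?L"
      proof (rule INF_greatest)
        fix \<omega> assume "\<omega> \<in> itineraries T B x"
        then have "?K - c \<le> AIC_word U enc (length B) (map \<omega> [0..<n])" using le [of \<omega> n] by simp
        then have "(?K - c) / f n \<le> AIC_word U enc (length B) (map \<omega> [0..<n]) / f n"
          using f by (intro divide_right_mono) auto
        then show "ereal (?K / f n - real c / f n)
            \<le> ereal (real (AIC_word U enc (length B) (map \<omega> [0..<n])) / f n)"
          by (simp add: diff_divide_distrib)
      qed
      then have "ereal (real c / f n) + ereal (?K / f n - real c / f n) \<le> ereal (real c / f n) + ?L"
        by (rule add_left_mono)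
      then show "ereal (?K / f n) \<le> ereal (real c / f n) + ?L" by simp
    qed
    also have "\<dots> \<le> orbit_complexity U enc f T x"
      unfolding orbit_complexity_def using B by (intro SUP_upper) simp
    finally show "shadow_complexity_at U Q I f T x \<epsilon> \<le> orbit_complexity U enc f T x" .
  qed
  show "orbit_complexity U enc f T x \<le> shadow_complexity U Q I f T x"
    unfolding orbit_complexity_def
  proof (rule SUP_least)
    fix B :: "'a set list" assume "B \<in> {B. open_cover B}"
    then have "open_cover B" by simp
    from itinerary_le_shadow_length [OF assms(1-5,10) I this]
    obtain \<epsilon> c where \<epsilon>: "\<epsilon> > 0" and le: "\<And>n. \<exists>\<omega>\<in>itineraries T B x.
      AIC_word U enc (length B) (map \<omega> [0..<n]) \<le> shadow_length U Q I T x n \<epsilon> + c" by blast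
    have "cover_complexity U enc f T B x \<le> shadow_complexity_at U Q I f T x \<epsilon>"
      unfolding shadow_complexity_at_def cover_complexity_def
    proof (rule limsup_le_of_bounded_difference [OF assms(9)])
      fix n assume f: "f n > 0"
      let ?K = "real (shadow_length U Q I T x n \<epsilon>)"
      obtain \<omega> where \<omega>: "\<omega> \<in> itineraries T B x"
        "AIC_word U enc (length B) (map \<omega> [0..<n]) \<le> shadow_length U Q I T x n \<epsilon> + c"
        using le by blast
      have "(INF \<omega>\<in>itineraries T B x. ereal (real (AIC_word U enc (length B) (map \<omega> [0..<n])) / f n))
          \<le> ereal (real (AIC_word U enc (length B) (map \<omega> [0..<n])) / f n)"
        using \<omega>(1) by (rule INF_lower)
      also have "\<dots> \<le> ereal ((real c + ?K) / f n)"
        using \<omega>(2) f by (simp add: divide_right_mono)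
      also have "\<dots> = ereal (real c / f n) + ereal (?K / f n)"
        by (simp add: add_divide_distrib)
      finally show "(INF \<omega>\<in>itineraries T B x.
          ereal (real (AIC_word U enc (length B) (map \<omega> [0..<n])) / f n))
          \<le> ereal (real c / f n) + ereal (?K / f n)" .
    qed
    also have "\<dots> \<le> shadow_complexity U Q I f T x"
      unfolding shadow_complexity_def using \<epsilon> by (intro SUP_upper) simp
    finally show "cover_complexity U enc f T B x \<le> shadow_complexity U Q I f T x" .
  qed
qed

end
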